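(* Let $(X,\leq)$ be any (nonempty) poset. Then the set-valued statistics $\mathrm{DES}$ (set of descents) and $\mathrm{RISE}$ (set of rises) are equidistributed over each equivalence class of the partially commutative monoid $L(X,\leq)$; that is, for every $w\in X^*$ and every set $S$ of positive integers, the number of words $w'\in[w]$ with $\mathrm{DES}(w')=S$ equals the number of words $w'\in[w]$ with $\mathrm{RISE}(w')=S$.
   Context: $X^*$ is the free monoid of finite words over $X$. Two words $w,w'\in X^*$ are adjacent if there are words $u,v\in X^*$ and distinct comparable elements $a,a'\in X$ (i.e. $a<a'$ or $a>a'$) with $w=uaa'v$ and $w'=ua'av$. Two words are equivalent if they are equal or connected by a finite sequence of words in which consecutive words are adjacent. This is an equivalence relation compatible with concatenation; $L(X,\leq)$ is the quotient monoid and $[w]$ denotes the equivalence class of $w$. For $w=x_1x_2\cdots x_n\in X^*$, $\mathrm{DES}(w)=\{i: 1\le i\le n-1,\ x_i>x_{i+1}\}$ and $\mathrm{RISE}(w)=\{i:1\le i\le n-1,\ x_i<x_{i+1}\}$. *)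

theory Defs
  imports Main "HOL-Library.Multiset"
begin

text \<open>The poset is the type \<^typ>\<open>'a::order\<close> (types are nonempty), and the free monoid of
  finite words over it is \<^typ>\<open>'a list\<close> with concatenation.\<close>

definition adjacent :: "'a::order list \<Rightarrow> 'a list \<Rightarrow> bool" where
  "adjacent w w' \<longleftrightarrow>
     (\<exists>u v a a'. (a < a' \<or> a > a') \<and> w = u @ [a, a'] @ v \<and> w' = u @ [a', a] @ v)"

definition equivalent :: "'a::order list \<Rightarrow> 'a list \<Rightarrow> bool" where
  "equivalent = adjacent\<^sup>*\<^sup>*"

text \<open>The class \<open>[w]\<close>, an element of the quotient monoid \<open>L(X, \<le>)\<close>.\<close>

definition word_class :: "'a::order list \<Rightarrow> 'a list set" where
  "word_class w = {w'. equivalent w w'}"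

text \<open>Positions are counted from 1, whereas list indices start at 0.\<close>

definition DES :: "'a::order list \<Rightarrow> nat set" where
  "DES w = {i. 1 \<le> i \<and> i < length w \<and> w ! (i - 1) > w ! i}"

definition RISE :: "'a::order list \<Rightarrow> nat set" where
  "RISE w = {i. 1 \<le> i \<and> i < length w \<and> w ! (i - 1) < w ! i}"

lemma adjacent_sym: "adjacent w w' \<Longrightarrow> adjacent w' w"
  unfolding adjacent_def by blast

lemma equivp_equivalent: "equivp (equivalent :: 'a::order list \<Rightarrow> 'a list \<Rightarrow> bool)"
proof (rule equivpI)
  show "reflp (equivalent :: 'a list \<Rightarrow> 'a list \<Rightarrow> bool)"
    by (simp add: equivalent_def reflp_def)
  show "symp (equivalent :: 'a list \<Rightarrow> 'a list \<Rightarrow> bool)"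
    unfolding equivalent_def by (rule symp_rtranclp) (auto intro: sympI adjacent_sym)
  show "transp (equivalent :: 'a list \<Rightarrow> 'a list \<Rightarrow> bool)"
    unfolding equivalent_def by simp
qed

lemma adjacent_context: "adjacent w w' \<Longrightarrow> adjacent (p @ w @ q) (p @ w' @ q)"
  unfolding adjacent_def by (metis append.assoc)

lemma equivalent_context: "equivalent w w' \<Longrightarrow> equivalent (p @ w @ q) (p @ w' @ q)"
  unfolding equivalent_def
  by (induction rule: rtranclp_induct)
     (auto intro: rtranclp.rtrancl_into_rtrancl adjacent_context)

lemma equivalent_append:
  assumes "equivalent u u'" and "equivalent v v'"
  shows "equivalent (u @ v) (u' @ v')"
  using equivalent_context[OF assms(1), of "[]" v] equivalent_context[OF assms(2), of u' "[]"]
  by (simp add: equivalent_def)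

lemma equivalent_mset: "equivalent w w' \<Longrightarrow> mset w' = mset w"
  unfolding equivalent_def
  by (induction rule: rtranclp_induct) (auto simp: adjacent_def add_mset_commute)

text \<open>Classes are finite, so \<^const>\<open>card\<close> counts their subsets correctly.\<close>

lemma finite_word_class: "finite (word_class w)"
proof (rule finite_subset)
  show "word_class w \<subseteq> {w'. set w' \<subseteq> set w \<and> length w' = length w}"
    unfolding word_class_def
    by (auto dest!: equivalent_mset dest: mset_eq_setD mset_eq_length)
  show "finite {w'. set w' \<subseteq> set w \<and> length w' = length w}"
    by (rule finite_lists_length_eq) simp
qed

end

theory Submission
  imports Defs
begin

text \<open>A word whose set of descents contains \<open>T\<close> is a product of strictly decreasing blocks cut at
  the positions outside \<open>T\<close>. The letters of each block are pairwise comparable, so reversing every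
  block stays in the equivalence class, and it turns the descents at \<open>T\<close> into rises at \<open>T\<close>.
  Hence, for every \<open>T\<close>, the words of a class with \<open>T \<subseteq> DES\<close> and those with
  \<open>T \<subseteq> RISE\<close> are equinumerous, and inclusion-exclusion gives equidistribution.\<close>

text \<open>Inclusion-exclusion without signs, by downward induction on \<open>S\<close> inside
  \<open>U\<close>: removing from the superset count of \<open>S\<close> the exact counts of its
  proper supersets in \<open>U\<close> leaves the exact count of \<open>S\<close>, and those
  subtracted counts agree for \<open>f\<close> and \<open>g\<close> by induction.\<close>

lemma card_fibre_eqI:
  fixes f g :: "'a \<Rightarrow> 'b set"
  assumes "finite A" and "finite U"
    and "\<And>x. x \<in> A \<Longrightarrow> f x \<subseteq> U" and "\<And>x. x \<in> A \<Longrightarrow> g x \<subseteq> U"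
    and superset: "\<And>T. card {x \<in> A. T \<subseteq> f x} = card {x \<in> A. T \<subseteq> g x}"
  shows "card {x \<in> A. f x = S} = card {x \<in> A. g x = S}"
proof (induction "card (U - S)" arbitrary: S rule: less_induct)
  case less
  let ?V = "{V. S \<subset> V \<and> V \<subseteq> U}"
  have "finite ?V"
    by (rule finite_subset[of _ "Pow U"]) (use \<open>finite U\<close> in auto)
  have split: "card {x \<in> A. S \<subseteq> h x} = card {x \<in> A. h x = S} + (\<Sum>V\<in>?V. card {x \<in> A. h x = V})"
    if "\<And>x. x \<in> A \<Longrightarrow> h x \<subseteq> U" for h
  proof -
    have "{x \<in> A. S \<subseteq> h x} = {x \<in> A. h x = S} \<union> (\<Union>V\<in>?V. {x \<in> A. h x = V})"
      using that by auto
    moreover have "card (\<Union>V\<in>?V. {x \<in> A. h x = V}) = (\<Sum>V\<in>?V. card {x \<in> A. h x = V})"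
      by (rule card_UN_disjoint) (use \<open>finite ?V\<close> \<open>finite A\<close> in auto)
    moreover have "card ({x \<in> A. h x = S} \<union> (\<Union>V\<in>?V. {x \<in> A. h x = V}))
        = card {x \<in> A. h x = S} + card (\<Union>V\<in>?V. {x \<in> A. h x = V})"
      by (rule card_Un_disjoint) (use \<open>finite ?V\<close> \<open>finite A\<close> in auto)
    ultimately show ?thesis by simp
  qed
  have "card {x \<in> A. f x = V} = card {x \<in> A. g x = V}" if "V \<in> ?V" for V
    by (rule less) (use that \<open>finite U\<close> in \<open>auto intro!: psubset_card_mono\<close>)
  then have "(\<Sum>V\<in>?V. card {x \<in> A. f x = V}) = (\<Sum>V\<in>?V. card {x \<in> A. g x = V})"
    by simp
  with split[of f] split[of g] superset[of S] assms(3,4) show ?case by simp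
qed

lemma equivalent_refl [simp]: "equivalent w w"
  by (simp add: equivalent_def)

lemma equivalent_trans: "equivalent u v \<Longrightarrow> equivalent v w \<Longrightarrow> equivalent u w"
  by (simp add: equivalent_def)

lemma equivalent_Cons_snoc:
  assumes "\<forall>y\<in>set ys. x < y \<or> y < x"
  shows "equivalent (x # ys) (ys @ [x])"
  using assms
proof (induction ys)
  case (Cons y ys)
  have "adjacent (x # y # ys) (y # x # ys)"
    unfolding adjacent_def using Cons.prems
    by (intro exI[of _ "[]"] exI[of _ ys] exI[of _ x] exI[of _ y]) auto
  then have "equivalent (x # y # ys) (y # x # ys)"
    by (simp add: equivalent_def)
  moreover have "equivalent (y # x # ys) (y # ys @ [x])"
    using equivalent_append[of "[y]" "[y]" "x # ys" "ys @ [x]"] Cons by simp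
  ultimately show ?case
    by (auto intro: equivalent_trans)
qed simp

text \<open>Comparability is not transitive in general, so \<open>sorted_wrt\<close> here demands it
  of every pair of letters, not just of neighbours. Hence the first letter can travel to the end by
  adjacent swaps, and the tail is reversed by induction.\<close>

lemma equivalent_rev:
  assumes "sorted_wrt (\<lambda>x y. x < y \<or> y < x) xs"
  shows "equivalent xs (rev xs)"
  using assms
proof (induction xs)
  case (Cons x xs)
  then have "equivalent (x # xs) (xs @ [x])"
    by (simp add: equivalent_Cons_snoc)
  moreover have "equivalent (xs @ [x]) (rev xs @ [x])"
    using Cons by (intro equivalent_append) auto
  ultimately show ?case
    by (auto intro: equivalent_trans)
qed simp

text \<open>The first cut in a word of length \<open>n\<close>. The disjunct
  \<open>n \<le> k\<close> makes the end of the word a cut as well, so the minimum exists even when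
  \<open>T\<close> contains every position.\<close>

definition block_length :: "nat set \<Rightarrow> nat \<Rightarrow> nat" where
  "block_length T n = (LEAST k. 1 \<le> k \<and> (k \<notin> T \<or> n \<le> k))"

lemma block_length:
  assumes "0 < n"
  shows block_length_pos: "0 < block_length T n"
    and block_length_le: "block_length T n \<le> n"
    and block_length_notin: "block_length T n \<notin> T \<or> block_length T n = n"
    and less_block_length: "1 \<le> i \<Longrightarrow> i < block_length T n \<Longrightarrow> i \<in> T"
proof -
  have *: "1 \<le> n \<and> (n \<notin> T \<or> n \<le> n)" using assms by simp
  show le: "block_length T n \<le> n"
    unfolding block_length_def by (rule Least_le) (rule *)
  show "0 < block_length T n" "block_length T n \<notin> T \<or> block_length T n = n"
    using LeastI[of "\<lambda>k. 1 \<le> k \<and> (k \<notin> T \<or> n \<le> k)", OF *] le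
    unfolding block_length_def by auto
  show "i \<in> T" if "1 \<le> i" "i < block_length T n"
    using not_less_Least[of i "\<lambda>k. 1 \<le> k \<and> (k \<notin> T \<or> n \<le> k)"] that
    unfolding block_length_def by auto
qed

text \<open>The set \<open>{i. i + k \<in> T}\<close> is \<open>T\<close> renumbered from the start
  of the remaining word.\<close>

function block_rev :: "nat set \<Rightarrow> 'a list \<Rightarrow> 'a list" where
  "block_rev T w = (if w = [] then [] else
     let k = block_length T (length w)
     in rev (take k w) @ block_rev {i. i + k \<in> T} (drop k w))"
  by pat_completeness auto
termination
  by (relation "measure (\<lambda>(T, w). length w)") (auto simp: block_length_pos)

declare block_rev.simps [simp del]

lemma block_rev_Nil [simp]: "block_rev T [] = []"
  by (simp add: block_rev.simps)

lemma block_rev_nonempty: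
  "w \<noteq> [] \<Longrightarrow> k = block_length T (length w) \<Longrightarrow>
   block_rev T w = rev (take k w) @ block_rev {i. i + k \<in> T} (drop k w)"
  by (subst block_rev.simps) (simp add: Let_def)

lemma length_block_rev [simp]: "length (block_rev T w) = length w"
proof (induction T w rule: block_rev.induct)
  case (1 T w)
  then show ?case
    by (cases "w = []") (auto simp: block_rev_nonempty block_length_le)
qed

text \<open>The cuts depend only on \<open>T\<close> and the length of the word, so the second pass
  finds the same blocks and undoes each reversal.\<close>

lemma block_rev_block_rev: "block_rev T (block_rev T w) = w"
proof (induction T w rule: block_rev.induct)
  case (1 T w)
  show ?case
  proof (cases "w = []")
    case False
    define k where "k = block_length T (length w)"
    have k: "k \<le> length w"
      unfolding k_def using False by (simp add: block_length_le)
    have rw: "block_rev T w = rev (take k w) @ block_rev {i. i + k \<in> T} (drop k w)"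
      using False k_def by (rule block_rev_nonempty)
    have "block_rev T w \<noteq> []"
      using False by (metis length_block_rev length_0_conv)
    then have "block_rev T (block_rev T w)
        = rev (take k (block_rev T w)) @ block_rev {i. i + k \<in> T} (drop k (block_rev T w))"
      by (rule block_rev_nonempty) (simp add: k_def)
    also have "\<dots> = take k w @ block_rev {i. i + k \<in> T} (block_rev {i. i + k \<in> T} (drop k w))"
      using k by (simp add: rw)
    also have "\<dots> = w"
      using "1.IH"[OF False k_def] by simp
    finally show ?thesis .
  qed simp
qed

text \<open>The relation is a parameter so that descents and rises share one argument. Positions out
  of range are ignored, so the recursion on shifted sets carries no range condition.\<close>

definition steps_at :: "('a \<Rightarrow> 'a \<Rightarrow> bool) \<Rightarrow> nat set \<Rightarrow> 'a list \<Rightarrow> bool" where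
  "steps_at R T w \<longleftrightarrow> (\<forall>i\<in>T. 1 \<le> i \<longrightarrow> i < length w \<longrightarrow> R (w ! (i - 1)) (w ! i))"

lemma steps_at_drop: "steps_at R T w \<Longrightarrow> steps_at R {i. i + k \<in> T} (drop k w)"
  unfolding steps_at_def
proof (intro ballI impI, goal_cases)
  case (1 i)
  then have "R (w ! (i + k - 1)) (w ! (i + k))" by auto
  with 1 show ?case by (simp add: add.commute)
qed

lemma steps_at_block_rev:
  "steps_at R T w \<Longrightarrow> steps_at (\<lambda>x y. R y x) T (block_rev T w)"
proof (induction T w rule: block_rev.induct)
  case (1 T w)
  show ?case
  proof (cases "w = []")
    case False
    define k where "k = block_length T (length w)"
    have k: "0 < k" "k \<le> length w" "k \<notin> T \<or> k = length w"
      unfolding k_def using False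
      using block_length_notin[of "length w" T] by (simp_all add: block_length_pos block_length_le)
    define v where "v = block_rev {i. i + k \<in> T} (drop k w)"
    have IH: "steps_at (\<lambda>x y. R y x) {i. i + k \<in> T} v"
      unfolding v_def using "1.IH"[OF False k_def] steps_at_drop[OF "1.prems"] by simp
    have rw: "block_rev T w = rev (take k w) @ v"
      unfolding v_def using False k_def by (rule block_rev_nonempty)
    have v: "length v = length w - k" by (simp add: v_def)
    show ?thesis
      unfolding steps_at_def
    proof (intro ballI impI)
      fix i assume i: "i \<in> T" "1 \<le> i" "i < length (block_rev T w)"
      \<comment> \<open>The junction \<open>i = k\<close> is excluded: either \<open>k\<close> is a
        cut outside \<open>T\<close>, or the word ends there.\<close>
      consider "i < k" | "k < i" using k i by force
      then show "R (block_rev T w ! i) (block_rev T w ! (i - 1))"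
      proof cases
        case 1
        \<comment> \<open>Reversing the block carries the step at \<open>k - i\<close> to the step
          at \<open>i\<close>, and every position strictly inside the block lies in
          \<open>T\<close>.\<close>
        with i have "k - i \<in> T"
          unfolding k_def using False by (intro less_block_length[of "length w"]) auto
        with \<open>steps_at R T w\<close> 1 k i have "R (w ! (k - i - 1)) (w ! (k - i))"
          unfolding steps_at_def by auto
        moreover have "i - 1 < k" using 1 by simp
        ultimately show ?thesis using 1 k i by (simp add: rw nth_append rev_nth)
      next
        case 2
        then have "i - k + k \<in> T" "1 \<le> i - k" "i - k < length v"
          using i v by simp_all
        with IH have "R (v ! (i - k)) (v ! (i - k - 1))"
          unfolding steps_at_def by blast
        \<comment> \<open>Both letters of the step lie beyond the first block, so both are read from
          \<open>v\<close>.\<close>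
        moreover have "\<not> i - 1 < k" using 2 by simp
        ultimately show ?thesis using 2 k i by (simp add: rw nth_append diff_right_commute)
      qed
    qed
  qed (simp add: steps_at_def)
qed

text \<open>Membership in \<open>T\<close> only controls neighbouring letters; transitivity of
  \<open>R\<close> extends this to all pairs within a block, as reversal by swaps requires.\<close>

lemma equivalent_block_rev:
  fixes w :: "'a::order list"
  assumes "transp R" and "\<And>x y. R x y \<Longrightarrow> x < y \<or> y < x"
  shows "steps_at R T w \<Longrightarrow> equivalent w (block_rev T w)"
proof (induction T w rule: block_rev.induct)
  case (1 T w)
  show ?case
  proof (cases "w = []")
    case False
    define k where "k = block_length T (length w)"
    have "k \<le> length w"
      unfolding k_def using False by (simp add: block_length_le)
    have "R (w ! i) (w ! Suc i)" if "Suc i < k" for i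
    proof -
      have "Suc i \<in> T"
        using that False unfolding k_def by (intro less_block_length[of "length w"]) auto
      with "1.prems" that \<open>k \<le> length w\<close> show ?thesis unfolding steps_at_def by fastforce
    qed
    with \<open>k \<le> length w\<close> have "sorted_wrt R (take k w)"
      using \<open>transp R\<close> by (simp add: sorted_wrt_iff_nth_Suc_transp)
    then have "sorted_wrt (\<lambda>x y. x < y \<or> y < x) (take k w)"
      by (rule sorted_wrt_mono_rel[rotated]) (use assms(2) in auto)
    then have "equivalent (take k w) (rev (take k w))"
      by (rule equivalent_rev)
    moreover have "equivalent (drop k w) (block_rev {i. i + k \<in> T} (drop k w))"
      using "1.IH"[OF False k_def] steps_at_drop[OF "1.prems"] by simp
    ultimately have "equivalent (take k w @ drop k w) (block_rev T w)"
      unfolding block_rev_nonempty[OF False k_def] by (rule equivalent_append)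
    then show ?thesis by simp
  qed simp
qed

lemma subset_DES_iff: "T \<subseteq> {1..<length w} \<Longrightarrow> T \<subseteq> DES w \<longleftrightarrow> steps_at (>) T w"
  unfolding DES_def steps_at_def by fastforce

lemma subset_RISE_iff: "T \<subseteq> {1..<length w} \<Longrightarrow> T \<subseteq> RISE w \<longleftrightarrow> steps_at (<) T w"
  unfolding RISE_def steps_at_def by fastforce

lemma length_word_class: "w' \<in> word_class w \<Longrightarrow> length w' = length w"
  unfolding word_class_def by (auto dest: equivalent_mset mset_eq_length)

lemma card_DES_superset:
  "card {w' \<in> word_class w. T \<subseteq> DES w'} = card {w' \<in> word_class w. T \<subseteq> RISE w'}"
proof (cases "T \<subseteq> {1..<length w}")
  case True
  have D: "{w' \<in> word_class w. T \<subseteq> DES w'} = {w' \<in> word_class w. steps_at (>) T w'}"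
    and R: "{w' \<in> word_class w. T \<subseteq> RISE w'} = {w' \<in> word_class w. steps_at (<) T w'}"
    using True subset_DES_iff[of T] subset_RISE_iff[of T] length_word_class by metis+
  \<comment> \<open>Being an involution that preserves the class and turns \<open>R\<close> at
    \<open>T\<close> into its converse, \<open>block_rev T\<close> serves as its own inverse between
    the two sets.\<close>
  have "bij_betw (block_rev T) {w' \<in> word_class w. steps_at (>) T w'}
      {w' \<in> word_class w. steps_at (<) T w'}"
  proof (rule bij_betw_byWitness[where f' = "block_rev T"])
    show "block_rev T ` {w' \<in> word_class w. steps_at (>) T w'}
        \<subseteq> {w' \<in> word_class w. steps_at (<) T w'}"
      using steps_at_block_rev[of "(>)" T] equivalent_block_rev[of "(>)" T]
      by (auto simp: word_class_def intro: equivalent_trans)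
    show "block_rev T ` {w' \<in> word_class w. steps_at (<) T w'}
        \<subseteq> {w' \<in> word_class w. steps_at (>) T w'}"
      using steps_at_block_rev[of "(<)" T] equivalent_block_rev[of "(<)" T]
      by (auto simp: word_class_def intro: equivalent_trans)
  qed (simp_all add: block_rev_block_rev)
  then show ?thesis
    unfolding D R by (rule bij_betw_same_card)
next
  case False
  \<comment> \<open>All words of the class have the length of \<open>w\<close>, so some element of
    \<open>T\<close> can be neither a descent nor a rise of any of them.\<close>
  then have "\<not> T \<subseteq> DES w'" "\<not> T \<subseteq> RISE w'" if "w' \<in> word_class w" for w'
    using length_word_class[OF that] by (auto simp: DES_def RISE_def)
  then have "{w' \<in> word_class w. T \<subseteq> DES w'} = {}" "{w' \<in> word_class w. T \<subseteq> RISE w'} = {}"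
    by blast+
  then show ?thesis by (simp only:)
qed

theorem theorem1p10:
  fixes w :: "'a::order list" and S :: "nat set"
  assumes "S \<subseteq> {1..}"
  shows "card {w' \<in> word_class w. DES w' = S} = card {w' \<in> word_class w. RISE w' = S}"
proof (rule card_fibre_eqI[OF finite_word_class])
  show "DES w' \<subseteq> {1..<length w}" "RISE w' \<subseteq> {1..<length w}" if "w' \<in> word_class w" for w'
    using length_word_class[OF that] by (auto simp: DES_def RISE_def)
qed (simp_all add: card_DES_superset)

end
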